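(* Suppose that a finite digraph $G=(V,E)$ without loops has a vertex $a$ such that there is only one outcoming edge $a\to b$ from $a$ and no incoming edges to $a$. Let $G'=(V',E')$ be the digraph with $V'=V\setminus\{a\}$ and $E'=E\setminus\{ab\}$. Then $H_p(G)\cong H_p(G')$ for all $p\ge0$.
   Context: Fix a field $\mathbb K$. A finite digraph $G=(V,E)$ consists of a finite vertex set $V$ and $E\subset V\times V$; write $i\to j$ (edge $ij$) if $(i,j)\in E$. No loops: never $i\to i$. For $p\ge 0$, an elementary $p$-path is a sequence $i_0\dots i_p$ of vertices; it is regular if $i_{k-1}\ne i_k$ for all $k$. $\mathcal R_p$ is the $\mathbb K$-vector space with basis $\{e_{i_0\dots i_p}: i_0\dots i_p\text{ regular}\}$. The regular boundary operator $\partial:\mathcal R_p\to\mathcal R_{p-1}$, $p\ge1$, is $\partial e_{i_0\dots i_p}=\sum_{q=0}^p(-1)^qe_{i_0\dots\widehat{i_q}\dots i_p}$, with every term indexed by a non-regular sequence replaced by $0$; $\partial=0$ on $\mathcal R_0$. An elementary path $i_0\dots i_p$ is allowed if $i_{k-1}\to i_k$ for all $k=1,\dots,p$. $\mathcal A_p$ is the span of $e_{i_0\dots i_p}$ over allowed $p$-paths, $\mathcal A_{-1}=\{0\}$, and $\Omega_p=\{v\in\mathcal A_p:\partial v\in\mathcal A_{p-1}\}$. The path homologies $H_p(G)$, $p\ge0$, are the homologies of the chain complex $0\leftarrow\Omega_0\leftarrow\Omega_1\leftarrow\cdots$ with differential $\partial$. *)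

theory Defs
  imports
    "HOL-Library.Poly_Mapping"
    "HOL-Library.Set_Algebras"
    "Graph_Theory.Pair_Digraph"
begin

text \<open>
  A path \<open>i\<^sub>0 \<dots> i\<^sub>p\<close> is the list \<open>[i\<^sub>0, \<dots>, i\<^sub>p]\<close> of length \<open>p + 1\<close>; a chain is a finitely supported
  function from such lists to the field \<open>'k\<close>.
\<close>

type_synonym ('v, 'k) chain = "'v list \<Rightarrow>\<^sub>0 'k"

abbreviation basis_path :: "'v list \<Rightarrow> ('v, 'k::field) chain" where
  "basis_path xs \<equiv> Poly_Mapping.single xs 1"

definition chain_scale :: "'k::field \<Rightarrow> ('v, 'k) chain \<Rightarrow> ('v, 'k) chain" where
  "chain_scale c v = Poly_Mapping.map ((*) c) v"

lemma lookup_chain_scale [simp]: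
  "Poly_Mapping.lookup (chain_scale c v) xs = c * Poly_Mapping.lookup v xs"
  by (simp add: chain_scale_def map.rep_eq when_def)

global_interpretation chain: vector_space "chain_scale :: 'k::field \<Rightarrow> ('v, 'k) chain \<Rightarrow> ('v, 'k) chain"
  by unfold_locales
    (simp_all add: poly_mapping_eq_iff fun_eq_iff lookup_add algebra_simps)


abbreviation regular_path :: "'v list \<Rightarrow> bool" where
  "regular_path xs \<equiv> distinct_adj xs"

definition regular_paths :: "'v pair_pre_digraph \<Rightarrow> nat \<Rightarrow> 'v list set" where
  "regular_paths G p = {xs. length xs = Suc p \<and> set xs \<subseteq> pverts G \<and> regular_path xs}"

definition regular_chains :: "'v pair_pre_digraph \<Rightarrow> nat \<Rightarrow> ('v, 'k::field) chain set" where
  "regular_chains G p = chain.span (basis_path ` regular_paths G p)"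

definition delete_nth :: "nat \<Rightarrow> 'v list \<Rightarrow> 'v list" where
  "delete_nth q xs = take q xs @ drop (Suc q) xs"

text \<open>
  The first case makes the boundary vanish on \<open>0\<close>-chains, instead of sending a vertex to the
  empty path (no reduced homology).
\<close>

definition boundary_path :: "'v list \<Rightarrow> ('v, 'k::field) chain" where
  "boundary_path xs =
    (if length xs \<le> 1 then 0
     else \<Sum>q<length xs.
       if regular_path (delete_nth q xs)
       then chain_scale ((-1) ^ q) (basis_path (delete_nth q xs)) else 0)"

text \<open>
  The linear extension to all chains; only its values on \<open>regular_chains\<close> are meaningful.
\<close>

definition boundary :: "('v, 'k::field) chain \<Rightarrow> ('v, 'k) chain" where
  "boundary v = (\<Sum>xs\<in>Poly_Mapping.keys v. chain_scale (Poly_Mapping.lookup v xs) (boundary_path xs))"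

definition allowed_paths :: "'v pair_pre_digraph \<Rightarrow> nat \<Rightarrow> 'v list set" where
  "allowed_paths G p =
    {xs. length xs = Suc p \<and> set xs \<subseteq> pverts G \<and> successively (\<lambda>u v. (u, v) \<in> parcs G) xs}"

definition allowed_chains :: "'v pair_pre_digraph \<Rightarrow> nat \<Rightarrow> ('v, 'k::field) chain set" where
  "allowed_chains G p = chain.span (basis_path ` allowed_paths G p)"

lemma (in pair_loopfree_digraph) allowed_chains_subset_regular_chains:
  "allowed_chains G p \<subseteq> regular_chains G p"
proof -
  have "regular_path xs" if "successively (\<lambda>u v. (u, v) \<in> parcs G) xs" for xs
    using successively_mono[OF that] pair_no_loops unfolding distinct_adj_def by fastforce
  then have "allowed_paths G p \<subseteq> regular_paths G p"
    by (auto simp: allowed_paths_def regular_paths_def)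
  then show ?thesis
    unfolding allowed_chains_def regular_chains_def by (intro chain.span_mono image_mono)
qed

definition Omega :: "'v pair_pre_digraph \<Rightarrow> nat \<Rightarrow> ('v, 'k::field) chain set" where
  "Omega G p = {v \<in> allowed_chains G p.
     boundary v \<in> (case p of 0 \<Rightarrow> {0} | Suc q \<Rightarrow> allowed_chains G q)}"

definition cycles :: "'v pair_pre_digraph \<Rightarrow> nat \<Rightarrow> ('v, 'k::field) chain set" where
  "cycles G p = {v \<in> Omega G p. boundary v = 0}"

definition boundaries :: "'v pair_pre_digraph \<Rightarrow> nat \<Rightarrow> ('v, 'k::field) chain set" where
  "boundaries G p = boundary ` Omega G (Suc p)"


text \<open>
  The class-based vector spaces of the library live on whole types; quotients of subspaces need
  an explicit carrier.
\<close>

record ('k, 'a) vspace =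
  vcarrier :: "'a set"
  vadd :: "'a \<Rightarrow> 'a \<Rightarrow> 'a"
  vscale :: "'k \<Rightarrow> 'a \<Rightarrow> 'a"

definition vspace_iso :: "('k, 'a) vspace \<Rightarrow> ('k, 'b) vspace \<Rightarrow> bool" (infix "\<cong>\<^sub>v" 50) where
  "U \<cong>\<^sub>v W \<longleftrightarrow> (\<exists>f. bij_betw f (vcarrier U) (vcarrier W)
    \<and> (\<forall>x\<in>vcarrier U. \<forall>y\<in>vcarrier U. f (vadd U x y) = vadd W (f x) (f y))
    \<and> (\<forall>c. \<forall>x\<in>vcarrier U. f (vscale U c x) = vscale W c (f x)))"

text \<open>
  The elements of \<open>Z / B\<close> are the cosets \<open>z + B\<close>, added as sets.  In the scalar multiple, the
  summand \<open>B\<close> is needed for \<open>c = 0\<close> only, where the image of a coset is just \<open>{0}\<close>.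
\<close>

definition quotient_vspace ::
    "('v, 'k::field) chain set \<Rightarrow> ('v, 'k) chain set \<Rightarrow> ('k, ('v, 'k) chain set) vspace" where
  "quotient_vspace Z B =
    \<lparr>vcarrier = (\<lambda>z. z +o B) ` Z, vadd = (+), vscale = (\<lambda>c X. chain_scale c ` X + B)\<rparr>"

definition path_homology ::
    "'v pair_pre_digraph \<Rightarrow> nat \<Rightarrow> ('k::field, ('v, 'k) chain set) vspace" where
  "path_homology G p = quotient_vspace (cycles G p) (boundaries G p)"

end

theory Submission
  imports Defs
begin

text \<open>
  A walk can meet the vertex \<open>a\<close> only as its first vertex, and its second vertex is then \<open>b\<close>.  Let
  \<open>v\<close> be a chain of allowed paths and \<open>a b z \<dots>\<close> a path in it.  Deleting \<open>b\<close> yields the path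
  \<open>a z \<dots>\<close>, which is regular but not allowed, since \<open>z \<noteq> b\<close>; and no other deletion from any
  path of \<open>v\<close> yields it.  So the coefficient of \<open>a z \<dots>\<close> in \<open>\<partial>v\<close> is minus that of \<open>a b z \<dots>\<close>
  in \<open>v\<close> (\<open>lookup_boundary_cone\<close>), and if \<open>\<partial>v\<close> is allowed, then \<open>a b z \<dots>\<close> does not occur in \<open>v\<close>
  after all.  The only path through \<open>a\<close> of positive length that this leaves is \<open>a b\<close>, the case of an
  empty tail, where the coefficient in question is that of the vertex \<open>a\<close> in \<open>\<partial>v\<close>.  Hence an
  element of \<open>\<Omega>\<^sub>p\<^sub>+\<^sub>1(G)\<close> whose boundary does not involve the vertex \<open>a\<close> lies in
  \<open>\<Omega>\<^sub>p\<^sub>+\<^sub>1(G')\<close> (\<open>Omega_G'I\<close>).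

  This one statement shows that the inclusion of \<open>G'\<close> into \<open>G\<close> induces an isomorphism in every
  degree.  It is injective because a boundary of \<open>G\<close> that is a cycle of \<open>G'\<close> has all its fillings
  in \<open>G'\<close> (\<open>boundaries_Int_cycles\<close>).  It is surjective because a cycle of positive degree has zero
  boundary, hence lies in \<open>G'\<close>, while in degree \<open>0\<close> the vertex \<open>a\<close> is homologous to \<open>b\<close> through
  the arc \<open>a b\<close> (\<open>cycles_subset\<close>).
\<close>


section \<open>Quotients by two pairs of nested subspaces\<close>

lemma coset_eq_iff:
  fixes B :: "('v, 'k::field) chain set"
  assumes "chain.subspace B"
  shows "x +o B = y +o B \<longleftrightarrow> x - y \<in> B"
proof
  assume "x +o B = y +o B"
  moreover have "x \<in> x +o B"
    using chain.subspace_0[OF assms] by (auto simp: elt_set_plus_def)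
  ultimately have "x \<in> y +o B" by simp
  then show "x - y \<in> B"
    by (auto simp: elt_set_plus_def)
next
  assume d: "x - y \<in> B"
  have "u + B' \<in> w +o B" if "u - w \<in> B" "B' \<in> B" for u w B'
    unfolding elt_set_plus_def
    using chain.subspace_add[OF assms that] by (auto intro!: bexI[of _ "u - w + B'"])
  moreover have "y - x \<in> B"
    using chain.subspace_neg[OF assms d] by simp
  ultimately show "x +o B = y +o B"
    using d by (auto simp: elt_set_plus_def)
qed

lemma coset_add:
  fixes B :: "('v, 'k::field) chain set"
  assumes "chain.subspace B"
  shows "(x +o B) + (y +o B) = (x + y) +o B"
proof -
  have "B + B = B"
    using chain.subspace_add[OF assms] chain.subspace_0[OF assms]
    by (force simp: set_plus_def)
  then show ?thesis
    by (simp add: set_plus_rearrange)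
qed

lemma coset_scale:
  fixes B :: "('v, 'k::field) chain set"
  assumes "chain.subspace B"
  shows "chain_scale c ` (x +o B) + B = chain_scale c x +o B" (is "?L = ?R")
proof
  show "?L \<subseteq> ?R"
    using chain.subspace_scale[OF assms] chain.subspace_add[OF assms]
    by (fastforce simp: set_plus_def elt_set_plus_def chain.scale_right_distrib add.assoc)
  have "chain_scale c x \<in> chain_scale c ` (x +o B)"
    using chain.subspace_0[OF assms] by (force simp: elt_set_plus_def)
  then show "?R \<subseteq> ?L"
    by (auto simp: elt_set_plus_def)
qed

text \<open>
  The map \<open>Z' / B' \<rightarrow> Z / B\<close> induced by the inclusion is injective by \<open>B \<inter> Z' \<subseteq> B'\<close> and
  surjective by \<open>Z \<subseteq> Z' + B\<close>.  The isomorphism used here is its inverse, which has an explicit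
  formula: for \<open>z \<in> Z'\<close>, the coset \<open>z + B\<close> meets \<open>Z'\<close> in \<open>z + (B \<inter> Z')\<close>, and adding \<open>B'\<close>
  enlarges this to \<open>z + B'\<close>.
\<close>

lemma quotient_iso_of_inclusion:
  fixes Z B Z' B' :: "('v, 'k::field) chain set"
  assumes Z: "chain.subspace Z" and B: "chain.subspace B"
    and Z': "chain.subspace Z'" and B': "chain.subspace B'"
    and "Z' \<subseteq> Z" and "B' \<subseteq> B" and inj: "B \<inter> Z' \<subseteq> B'" and surj: "Z \<subseteq> Z' + B"
  shows "quotient_vspace Z B \<cong>\<^sub>v quotient_vspace Z' B'"
proof -
  define f where "f X = (X \<inter> Z') + B'" for X
  have f: "f (z +o B) = z +o B'" if "z \<in> Z'" for z
  proof -
    have "w \<in> Z' \<longleftrightarrow> z + w \<in> Z'" for w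
      using chain.subspace_add[OF Z' that, of w] chain.subspace_diff[OF Z' _ that, of "z + w"]
      by auto
    then have "(z +o B) \<inter> Z' = z +o (B \<inter> Z')"
      by (auto simp: elt_set_plus_def)
    moreover have "(B \<inter> Z') + B' = B'"
    proof
      show "(B \<inter> Z') + B' \<subseteq> B'"
        using inj chain.subspace_add[OF B'] unfolding set_plus_def by blast
      have "0 \<in> B \<inter> Z'"
        using chain.subspace_0 B Z' by blast
      then show "B' \<subseteq> (B \<inter> Z') + B'"
        by (rule set_zero_plus2)
    qed
    ultimately show ?thesis
      by (simp add: f_def set_plus_rearrange3)
  qed
  have rep: "\<exists>z'\<in>Z'. z +o B = z' +o B" if "z \<in> Z" for z
  proof -
    from surj that obtain z' w where "z' \<in> Z'" "w \<in> B" "z = z' + w"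
      by (auto simp: set_plus_def)
    then show ?thesis
      by (intro bexI[of _ z']) (simp_all add: coset_eq_iff[OF B])
  qed
  have carrier: "(\<lambda>z. z +o B) ` Z = (\<lambda>z. z +o B) ` Z'"
    using rep \<open>Z' \<subseteq> Z\<close> by blast
  have "inj_on f ((\<lambda>z. z +o B) ` Z')"
    using \<open>B' \<subseteq> B\<close> by (auto simp: inj_on_def f coset_eq_iff[OF B] coset_eq_iff[OF B'])
  moreover have "f ` (\<lambda>z. z +o B) ` Z' = (\<lambda>z. z +o B') ` Z'"
    by (auto simp: image_image f)
  ultimately have "bij_betw f ((\<lambda>z. z +o B) ` Z') ((\<lambda>z. z +o B') ` Z')"
    by (simp add: bij_betw_def)
  then show ?thesis
    unfolding vspace_iso_def quotient_vspace_def
    by (intro exI[of _ f])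
      (simp add: carrier coset_add[OF B] coset_add[OF B'] coset_scale[OF B] coset_scale[OF B'] f
        chain.subspace_add[OF Z'] chain.subspace_scale[OF Z'])
qed


section \<open>Chains and their boundaries\<close>

lemma boundary_eq_sum:
  assumes "finite S" "Poly_Mapping.keys v \<subseteq> S"
  shows "boundary v = (\<Sum>xs\<in>S. chain_scale (Poly_Mapping.lookup v xs) (boundary_path xs))"
  unfolding boundary_def
  by (rule sum.mono_neutral_left) (use assms in \<open>auto simp: in_keys_iff\<close>)

lemma boundary_add: "boundary (u + v) = boundary u + boundary v"
proof -
  let ?S = "Poly_Mapping.keys u \<union> Poly_Mapping.keys v"
  show ?thesis
    using Poly_Mapping.keys_add[of u v]
    by (simp add: boundary_eq_sum[of ?S] lookup_add chain.scale_left_distrib sum.distrib)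
qed

lemma boundary_scale: "boundary (chain_scale c v) = chain_scale c (boundary v)"
proof -
  have "Poly_Mapping.keys (chain_scale c v) \<subseteq> Poly_Mapping.keys v"
    by (auto simp: in_keys_iff)
  then show ?thesis
    by (simp add: boundary_eq_sum[of "Poly_Mapping.keys v"] chain.scale_sum_right)
qed

lemma boundary_0: "boundary 0 = 0"
  by (simp add: boundary_def)

lemma boundary_basis_path: "boundary (basis_path xs) = boundary_path xs"
  by (simp add: boundary_def)

lemma lookup_boundary:
  "Poly_Mapping.lookup (boundary v) ys =
    (\<Sum>xs\<in>Poly_Mapping.keys v.
      Poly_Mapping.lookup v xs * Poly_Mapping.lookup (boundary_path xs) ys)"
  by (simp add: boundary_def lookup_sum)

lemma subspace_Omega: "chain.subspace (Omega G p)"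
proof -
  have "chain.subspace (case p of 0 \<Rightarrow> {0} | Suc q \<Rightarrow> allowed_chains G q)"
    by (auto simp: allowed_chains_def split: nat.split)
  moreover have "chain.subspace (allowed_chains G p)"
    by (simp add: allowed_chains_def)
  ultimately show ?thesis
    unfolding Omega_def chain.subspace_def by (auto simp: boundary_add boundary_scale boundary_0)
qed

lemma subspace_cycles: "chain.subspace (cycles G p)"
  using subspace_Omega[of G p]
  unfolding cycles_def chain.subspace_def by (auto simp: boundary_add boundary_scale boundary_0)

lemma subspace_boundaries: "chain.subspace (boundaries G p)"
  using subspace_Omega[of G "Suc p"]
  unfolding boundaries_def chain.subspace_def
  by (auto simp: image_iff boundary_0 simp flip: boundary_add boundary_scale)
    (metis boundary_0)

lemma allowed_chains_iff: "v \<in> allowed_chains G p \<longleftrightarrow> Poly_Mapping.keys v \<subseteq> allowed_paths G p"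
proof
  assume "v \<in> allowed_chains G p"
  then show "Poly_Mapping.keys v \<subseteq> allowed_paths G p"
    unfolding allowed_chains_def
  proof (induction rule: chain.span_induct_alt)
    case base
    then show ?case by simp
  next
    case (step c x y)
    then show ?case
      by (fastforce simp: in_keys_iff lookup_add lookup_single when_def split: if_splits)
  qed
next
  assume keys: "Poly_Mapping.keys v \<subseteq> allowed_paths G p"
  have "v = (\<Sum>xs\<in>Poly_Mapping.keys v. chain_scale (Poly_Mapping.lookup v xs) (basis_path xs))"
    by (rule poly_mapping_eqI)
      (simp add: lookup_sum lookup_single when_def in_keys_iff if_distrib[of "(*) _"] cong: if_cong)
  also have "\<dots> \<in> allowed_chains G p"
    unfolding allowed_chains_def
    by (intro chain.span_sum chain.span_scale chain.span_base) (use keys in auto)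
  finally show "v \<in> allowed_chains G p" .
qed


section \<open>Deleting one vertex from a path\<close>

text \<open>
  Deleting the first vertex leaves a path that starts with \<open>b\<close>; deleting a vertex after the second
  leaves \<open>b\<close> in the position where \<open>a # zs\<close> does not have it.
\<close>

lemma delete_nth_eq_iff:
  assumes "a \<noteq> b" "zs = [] \<or> hd zs \<noteq> b"
  shows "delete_nth q (a # b # zs') = a # zs \<longleftrightarrow> q = 1 \<and> zs' = zs"
proof (cases q)
  case (Suc r)
  then show ?thesis
    using assms by (cases r) (auto simp: delete_nth_def)
qed (use assms in \<open>auto simp: delete_nth_def\<close>)

lemma lookup_boundary_path:
  assumes "length xs > 1" "regular_path ys"
  shows "Poly_Mapping.lookup (boundary_path xs) ys =
    (\<Sum>q<length xs. if delete_nth q xs = ys then (- 1) ^ q else 0)"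
  unfolding boundary_path_def
  using assms by (auto simp: lookup_sum lookup_single when_def intro!: sum.cong)

lemma lookup_boundary_path_eq_0:
  assumes "\<And>q. q < length xs \<Longrightarrow> delete_nth q xs \<noteq> ys"
  shows "Poly_Mapping.lookup (boundary_path xs) ys = 0"
  using assms by (auto simp: boundary_path_def lookup_sum lookup_single when_def intro!: sum.neutral)

lemma lookup_boundary_path_cone:
  assumes "a \<noteq> b" "zs = [] \<or> hd zs \<noteq> b" "regular_path (a # zs)"
  shows "Poly_Mapping.lookup (boundary_path (a # b # zs')) (a # zs) =
    (if zs' = zs then - 1 else 0 :: 'k::field)"
proof -
  have "Poly_Mapping.lookup (boundary_path (a # b # zs')) (a # zs) =
    (\<Sum>q<length (a # b # zs'). if q = 1 then if zs' = zs then - 1 else 0 else 0 :: 'k)"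
    using assms(3)
    by (subst lookup_boundary_path)
      (auto simp: delete_nth_eq_iff[OF assms(1,2)] intro!: sum.cong simp del: sum.lessThan_Suc)
  then show ?thesis
    by (simp only: sum.delta finite_lessThan) simp
qed


section \<open>A source with a single outgoing arc\<close>

lemma successively_has_predecessor:
  assumes "successively R (x # ys)" "y \<in> set ys"
  shows "\<exists>u. R u y"
  using assms by (induction ys arbitrary: x) auto

locale pendant_source = pair_digraph G for G :: "'v pair_pre_digraph" +
  fixes a b :: 'v
  assumes a_in_verts: "a \<in> pverts G"
    and out_arcs_a: "out_arcs G a = {(a, b)}"
    and in_arcs_a: "in_arcs G a = {}"
begin

abbreviation G' :: "'v pair_pre_digraph" where
  "G' \<equiv> \<lparr>pverts = pverts G - {a}, parcs = parcs G - {(a, b)}\<rparr>"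

lemma arc_from_a_iff: "(a, y) \<in> parcs G \<longleftrightarrow> y = b"
  using out_arcs_a by (auto simp: out_arcs_def set_eq_iff)

lemma no_arc_to_a: "(x, a) \<notin> parcs G"
  using in_arcs_a by (auto simp: in_arcs_def)

lemma a_neq_b: "a \<noteq> b"
  using arc_from_a_iff no_arc_to_a by blast

lemma b_in_verts: "b \<in> pverts G"
  using arc_from_a_iff in_arcsD2 by blast

lemma allowed_path_through_a:
  assumes "xs \<in> allowed_paths G p" "a \<in> set xs"
  shows "xs = [a] \<or> (\<exists>zs. xs = a # b # zs)"
proof -
  obtain x ys where xs: "xs = x # ys"
    using assms by (cases xs) auto
  have "a \<notin> set ys"
    using assms(1) successively_has_predecessor no_arc_to_a unfolding xs allowed_paths_def by fast
  then have "x = a"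
    using assms(2) xs by simp
  then show ?thesis
    using assms(1) arc_from_a_iff by (cases ys) (auto simp: xs allowed_paths_def)
qed

lemma allowed_paths_G': "allowed_paths G' p = {xs \<in> allowed_paths G p. a \<notin> set xs}"
proof -
  have "successively (\<lambda>u v. (u, v) \<in> parcs G') xs = successively (\<lambda>u v. (u, v) \<in> parcs G) xs"
    if "a \<notin> set xs" for xs
    using that by (intro successively_cong) auto
  then show ?thesis
    unfolding allowed_paths_def by auto
qed

lemma Omega_G'_subset: "Omega G' p \<subseteq> Omega G p"
  by (auto simp: Omega_def allowed_chains_iff allowed_paths_G' split: nat.splits)

text \<open>
  A path of \<open>v\<close> that avoids \<open>a\<close> has no face through \<open>a\<close>.  The others have the form \<open>a # b # zs'\<close>,
  or \<open>[a]\<close> with boundary \<open>0\<close>, so \<open>a # b # zs\<close> is the only one that contributes.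
\<close>

lemma lookup_boundary_cone:
  fixes v :: "('v, 'k::field) chain"
  assumes v: "v \<in> allowed_chains G p" and zs: "zs = [] \<or> hd zs \<noteq> b" "regular_path (a # zs)"
  shows "Poly_Mapping.lookup (boundary v) (a # zs) = - Poly_Mapping.lookup v (a # b # zs)"
proof -
  have coeff: "Poly_Mapping.lookup (boundary_path xs :: ('v, 'k) chain) (a # zs) =
      (if xs = a # b # zs then - 1 else 0)" if "xs \<in> Poly_Mapping.keys v" for xs
  proof (cases "a \<in> set xs")
    case True
    have "xs \<in> allowed_paths G p"
      using that v by (auto simp: allowed_chains_iff)
    then consider "xs = [a]" | zs' where "xs = a # b # zs'"
      using allowed_path_through_a True by blast
    then show ?thesis
    proof cases
      case 1
      then show ?thesis
        by (simp add: boundary_path_def)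
    next
      case (2 zs')
      then show ?thesis
        by (simp add: lookup_boundary_path_cone[OF a_neq_b zs])
    qed
  next
    case False
    then have "delete_nth q xs \<noteq> a # zs" for q
      unfolding delete_nth_def
      by (metis Un_iff in_set_dropD in_set_takeD list.set_intros(1) set_append)
    then show ?thesis
      using False by (auto simp: lookup_boundary_path_eq_0)
  qed
  have "Poly_Mapping.lookup (boundary v) (a # zs) =
      (\<Sum>xs\<in>Poly_Mapping.keys v. if xs = a # b # zs then - Poly_Mapping.lookup v xs else 0)"
    unfolding lookup_boundary by (intro sum.cong) (auto simp: coeff)
  then show ?thesis
    by (simp add: in_keys_iff)
qed

text \<open>
  Since \<open>a z \<dots>\<close> with \<open>z \<noteq> b\<close> is not allowed, \<open>boundary v \<in> allowed_chains G p\<close> forces all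
  coefficients of \<open>v\<close> at paths through \<open>a\<close> to vanish, apart from the one at \<open>a b\<close>, whose face \<open>[a]\<close>
  is allowed; that one is controlled by the assumption on \<open>[a]\<close>.
\<close>

lemma Omega_G'I:
  fixes v :: "('v, 'k::field) chain"
  assumes v: "v \<in> Omega G (Suc p)" and 0: "Poly_Mapping.lookup (boundary v) [a] = 0"
  shows "v \<in> Omega G' (Suc p)"
proof -
  have vG: "v \<in> allowed_chains G (Suc p)" and dv: "boundary v \<in> allowed_chains G p"
    using v by (auto simp: Omega_def)
  have avoids: "a \<notin> set xs" if xs: "xs \<in> Poly_Mapping.keys v" for xs
  proof
    assume "a \<in> set xs"
    moreover have allowed: "xs \<in> allowed_paths G (Suc p)"
      using xs vG by (auto simp: allowed_chains_iff)
    ultimately obtain zs where zs: "xs = a # b # zs"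
      using allowed_path_through_a by (fastforce simp: allowed_paths_def)
    have arc: "zs = [] \<or> (b, hd zs) \<in> parcs G"
      and walk: "successively (\<lambda>u v. (u, v) \<in> parcs G) zs"
      using allowed by (cases zs; simp add: zs allowed_paths_def)+
    have hd: "zs = [] \<or> hd zs \<noteq> b \<and> hd zs \<noteq> a"
      using arc pair_no_loops[of "(b, hd zs)"] no_arc_to_a[of b] by auto
    have "regular_path zs"
      using successively_mono[OF walk] pair_no_loops unfolding distinct_adj_def by fastforce
    then have "regular_path (a # zs)"
      using hd by (cases zs) auto
    then have "Poly_Mapping.lookup (boundary v) (a # zs) = - Poly_Mapping.lookup v xs"
      using lookup_boundary_cone[OF vG] hd zs by blast
    moreover have "Poly_Mapping.lookup (boundary v) (a # zs) = 0"
    proof (cases zs)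
      case (Cons z zs')
      \<comment> \<open>The only arc out of \<open>a\<close> leads to \<open>b\<close>, while \<open>z \<noteq> b\<close>.\<close>
      then have "a # zs \<notin> allowed_paths G p"
        using hd arc_from_a_iff by (auto simp: allowed_paths_def)
      then show ?thesis
        using dv by (auto simp: allowed_chains_iff in_keys_iff)
    qed (use 0 in simp)
    ultimately show False
      using xs by (simp add: in_keys_iff)
  qed
  \<comment> \<open>Allowed paths of \<open>G'\<close> are those of \<open>G\<close> that avoid \<open>a\<close>, and faces inherit this from \<open>v\<close>.\<close>
  have "a \<notin> set ys" if "ys \<in> Poly_Mapping.keys (boundary v)" for ys
  proof
    assume "a \<in> set ys"
    have "\<exists>xs\<in>Poly_Mapping.keys v. Poly_Mapping.lookup (boundary_path xs) ys \<noteq> (0 :: 'k)"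
      using that unfolding in_keys_iff lookup_boundary
      by (metis (mono_tags, lifting) mult_zero_right sum.neutral)
    then obtain xs q where "xs \<in> Poly_Mapping.keys v" "ys = delete_nth q xs"
      using lookup_boundary_path_eq_0 by metis
    then show False
      using \<open>a \<in> set ys\<close> avoids unfolding delete_nth_def
      by (auto dest: in_set_takeD in_set_dropD)
  qed
  then show ?thesis
    using vG dv avoids by (auto simp: Omega_def allowed_chains_iff allowed_paths_G')
qed

lemma cycles_subset: "cycles G p \<subseteq> cycles G' p + (boundaries G p :: ('v, 'k::field) chain set)"
proof
  fix v :: "('v, 'k) chain"
  assume v: "v \<in> cycles G p"
  show "v \<in> cycles G' p + boundaries G p"
  proof (cases p)
    case (Suc q)
    then have "v \<in> Omega G (Suc q)" and "boundary v = 0"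
      using v by (auto simp: cycles_def)
    then have "v \<in> cycles G' p"
      using Omega_G'I[of v q] Suc by (simp add: cycles_def)
    moreover have "0 \<in> boundaries G p"
      by (rule chain.subspace_0[OF subspace_boundaries])
    ultimately have "v + 0 \<in> cycles G' p + boundaries G p"
      by (rule set_plus_intro)
    then show ?thesis
      by simp
  next
    case 0
    let ?e = "basis_path [a, b] :: ('v, 'k) chain" and ?c = "Poly_Mapping.lookup v [a]"
    have "boundary_path [a, b] = (basis_path [b] - basis_path [a] :: ('v, 'k) chain)"
      by (rule poly_mapping_eqI)
        (simp add: boundary_path_def delete_nth_def numeral_2_eq_2 lookup_add lookup_minus)
    then have de: "boundary ?e = basis_path [b] - basis_path [a]"
      by (simp only: boundary_basis_path)
    have "basis_path [x] \<in> allowed_chains G 0" if "x \<in> pverts G" for x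
      using that by (simp add: allowed_chains_iff allowed_paths_def)
    then have "boundary ?e \<in> allowed_chains G 0"
      unfolding de allowed_chains_def
      using a_in_verts b_in_verts by (intro chain.span_diff) (auto simp: allowed_chains_def)
    moreover have "?e \<in> allowed_chains G 1"
      using a_in_verts b_in_verts arc_from_a_iff by (auto simp: allowed_chains_iff allowed_paths_def)
    ultimately have "?e \<in> Omega G (Suc 0)"
      by (simp add: Omega_def)
    then have bd: "boundary (chain_scale (- ?c) ?e) \<in> boundaries G 0"
      unfolding boundaries_def by (intro imageI chain.subspace_scale[OF subspace_Omega])
    \<comment> \<open>Moving the mass that \<open>v\<close> has at \<open>a\<close> along the arc to \<open>b\<close> changes \<open>v\<close> by a boundary.\<close>
    define u where "u = v + chain_scale ?c (boundary ?e)"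
    have vG: "v \<in> allowed_chains G 0"
      using v 0 by (simp add: cycles_def Omega_def)
    have "u \<in> allowed_chains G 0"
      using vG \<open>boundary ?e \<in> allowed_chains G 0\<close> unfolding u_def allowed_chains_def
      by (intro chain.span_add chain.span_scale)
    moreover have "Poly_Mapping.lookup u [a] = 0"
      using a_neq_b by (simp add: u_def de lookup_add lookup_minus lookup_single)
    ultimately have allowed_u: "Poly_Mapping.keys u \<subseteq> allowed_paths G 0"
      and "[a] \<notin> Poly_Mapping.keys u"
      by (auto simp: allowed_chains_iff in_keys_iff)
    have "a \<notin> set xs" if "xs \<in> Poly_Mapping.keys u" for xs
    proof -
      have "length xs = 1"
        using that allowed_u by (auto simp: allowed_paths_def)
      moreover have "xs \<noteq> [a]"
        using that \<open>[a] \<notin> Poly_Mapping.keys u\<close> by blast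
      ultimately show ?thesis
        by (cases xs) auto
    qed
    then have keys_u: "Poly_Mapping.keys u \<subseteq> allowed_paths G' 0"
      using allowed_u by (auto simp: allowed_paths_G')
    moreover have "boundary u = 0"
      unfolding boundary_def
    proof (intro sum.neutral ballI)
      fix xs assume "xs \<in> Poly_Mapping.keys u"
      then have "length xs = 1"
        using allowed_u by (auto simp: allowed_paths_def)
      then show "chain_scale (Poly_Mapping.lookup u xs) (boundary_path xs) = 0"
        by (simp add: boundary_path_def)
    qed
    ultimately have "u \<in> cycles G' 0"
      by (simp add: cycles_def Omega_def allowed_chains_iff)
    moreover have "v = u + boundary (chain_scale (- ?c) ?e)"
      unfolding u_def boundary_scale by simp
    ultimately show ?thesis
      using set_plus_intro[OF _ bd, of u "cycles G' 0"] 0 by simp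
  qed
qed

lemma boundaries_Int_cycles: "boundaries G p \<inter> cycles G' p \<subseteq> boundaries G' p"
proof
  fix w assume w: "w \<in> boundaries G p \<inter> cycles G' p"
  then obtain v where v: "v \<in> Omega G (Suc p)" "w = boundary v"
    by (auto simp: boundaries_def)
  have "Poly_Mapping.lookup w [a] = 0"
    using w by (auto simp: cycles_def Omega_def allowed_chains_iff allowed_paths_G' in_keys_iff)
  then show "w \<in> boundaries G' p"
    using v Omega_G'I by (auto simp: boundaries_def)
qed

theorem path_homology_iso:
  "(path_homology G p :: ('k::field, ('v, 'k) chain set) vspace) \<cong>\<^sub>v path_homology G' p"
  unfolding path_homology_def
proof (rule quotient_iso_of_inclusion)
  show "cycles G' p \<subseteq> (cycles G p :: ('v, 'k) chain set)"
    using Omega_G'_subset by (auto simp: cycles_def)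
  show "boundaries G' p \<subseteq> (boundaries G p :: ('v, 'k) chain set)"
    using Omega_G'_subset by (auto simp: boundaries_def)
qed (rule subspace_cycles subspace_boundaries boundaries_Int_cycles cycles_subset)+

end

theorem theorem5p1:
  fixes G G' :: "'v pair_pre_digraph" and a b :: 'v and p :: nat
  assumes "pair_digraph G"
    and "a \<in> pverts G"
    and "out_arcs G a = {(a, b)}"
    and "in_arcs G a = {}"
    and "G' = \<lparr>pverts = pverts G - {a}, parcs = parcs G - {(a, b)}\<rparr>"
  shows "(path_homology G p :: ('k::field, ('v, 'k) chain set) vspace) \<cong>\<^sub>v path_homology G' p"
proof -
  interpret pair_digraph G by fact
  interpret pendant_source G a b by unfold_locales fact+
  show ?thesis
    unfolding assms(5) by (rule path_homology_iso)
qed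

end
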